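(* Let $k$ be a positive integer, $A$ a finite set, $\mathbb{F}$ a field, and $\mathcal{P}$ a property of $k$-tuples of elements of $A$. Let $T:A^k\to\mathbb{F}$ and $f:\Pi_k\setminus\{\hat{1}\}\to\mathbb{F}$ be such that (1) $(x,\ldots,x)$ satisfies $\mathcal{P}$ for every $x\in A$; (2) $T(x_1,\ldots,x_k)=1$ if $(x_1,\ldots,x_k)$ satisfies $\mathcal{P}$, and $T(x_1,\ldots,x_k)=0$ otherwise; (3) for every $\pi\in\Pi_k\setminus\{\hat{1}\}$, if some $(x_1,\ldots,x_k)\in A^k$ with partition $\pi$ satisfies $\mathcal{P}$, then $f(\pi)=0$; (4) $\sum_{\pi\in\Pi_k,\ \pi<\hat{1}} f(\pi)\,\mu(\pi,\hat{1})\neq 0$. Then $|A|\le \operatorname{partition-rank}(I_f\cdot T)$, where $I_f\cdot T$ is the pointwise product.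
   Context: $\Pi_k$ is the set of set partitions of $\{1,\ldots,k\}$ ordered by refinement ($\pi'\le\pi$ if every block of $\pi'$ lies in a block of $\pi$), with minimum $\hat{0}$ (all singletons) and maximum $\hat{1}$ (one block). The Möbius function $\mu$ of $\Pi_k$: $\mu(x,x)=1$, $\mu(x,y)=-\sum_{x\le z<y}\mu(x,z)$ for $x<y$, $\mu(x,y)=0$ otherwise (integer values read in $\mathbb{F}$). For $\pi\in\Pi_k$, $\delta_\pi(x_1,\ldots,x_k)=1$ if $x_i=x_j$ whenever $i,j$ are in the same block of $\pi$, and $0$ otherwise. The partition of $(x_1,\ldots,x_k)$ is the partition of $\{1,\ldots,k\}$ in which $i,j$ share a block iff $x_i=x_j$. The partition indicator of $f$ is $I_f:A^k\to\mathbb{F}$, \[I_f(x_1,\ldots,x_k)=\sum_{\tau\in\Pi_k,\ \tau<\hat{1}}\Big(\sum_{\pi\le\tau} f(\pi)\mu(\pi,\tau)\Big)\delta_\tau(x_1,\ldots,x_k).\] A function $T:A^k\to\mathbb{F}$ has partition rank $1$ if there is a partition $\pi_1\cdots\pi_r$ of $\{1,\ldots,k\}$ with $r\ge2$ blocks and functions $T_i$ of the variables $(x_j)_{j\in\pi_i}$ with $T=\prod_i T_i$; the partition rank is the least number of partition-rank-$1$ functions summing to $T$. *)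

theory Defs
  imports
    Main
    "HOL-Library.Disjoint_Sets"
    "HOL-Library.FuncSet"
    "HOL-Library.Extended_Nat"
begin

definition set_partitions :: "nat \<Rightarrow> nat set set set" where
  "set_partitions k = {\<pi>. partition_on {1..k} \<pi>}"

definition one_block :: "nat \<Rightarrow> nat set set" where
  "one_block k = {{1..k}}"

definition strictly_refines :: "nat \<Rightarrow> nat set set \<Rightarrow> nat set set \<Rightarrow> bool" where
  "strictly_refines k \<pi> \<tau> \<longleftrightarrow> refines {1..k} \<pi> \<tau> \<and> \<pi> \<noteq> \<tau>"

function mobius :: "nat \<Rightarrow> nat set set \<Rightarrow> nat set set \<Rightarrow> int" where
  "mobius k x y =
     (if x \<in> set_partitions k \<and> x = y then 1
      else if strictly_refines k x y
        then - (\<Sum>z\<in>{z. refines {1..k} x z \<and> strictly_refines k z y}. mobius k x z)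
      else 0)"
  by auto
termination
proof (relation "measure (\<lambda>(k, x, y). card {z. refines {1..k} z y})", goal_cases)
  case 1
  show ?case by simp
next
  case (2 k x y z)
  then have zy: "refines {1..k} z y" "z \<noteq> y"
    by (auto simp: strictly_refines_def)
  then have yy: "refines {1..k} y y"
    by (auto simp: refines_def)
  have "{w. refines {1..k} w y} \<subseteq> {w. partition_on {1..k} w}"
    by (auto simp: refines_def)
  then have "finite {w. refines {1..k} w y}"
    using finitely_many_partition_on[of "{1..k}"] finite_subset by blast
  moreover have "{w. refines {1..k} w z} \<subset> {w. refines {1..k} w y}"
    using zy yy refines_trans refines_asym by blast
  ultimately show ?case
    by (simp add: psubset_card_mono)
qed

declare mobius.simps [simp del]

definition delta :: "nat set set \<Rightarrow> (nat \<Rightarrow> 'a) \<Rightarrow> 'f::field" where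
  "delta \<pi> x = (if \<forall>B\<in>\<pi>. \<forall>i\<in>B. \<forall>j\<in>B. x i = x j then 1 else 0)"

text \<open>
  The set \<open>A\<^sup>k\<close> is rendered as the extensional function space
  \<open>{1..k} \<rightarrow>\<^sub>E A\<close>. Functions on \<open>A\<^sup>k\<close>, and functions on the partitions
  other than the one-block partition, are total HOL functions whose values outside these
  domains are never used.
\<close>

abbreviation tuples :: "nat \<Rightarrow> 'a set \<Rightarrow> (nat \<Rightarrow> 'a) set" where
  "tuples k A \<equiv> {1..k} \<rightarrow>\<^sub>E A"

definition tuple_partition :: "nat \<Rightarrow> (nat \<Rightarrow> 'a) \<Rightarrow> nat set set" where
  "tuple_partition k x = {1..k} // {(i, j). i \<in> {1..k} \<and> j \<in> {1..k} \<and> x i = x j}"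

definition partition_indicator ::
    "nat \<Rightarrow> (nat set set \<Rightarrow> 'f::field) \<Rightarrow> (nat \<Rightarrow> 'a) \<Rightarrow> 'f" where
  "partition_indicator k f x =
     (\<Sum>\<tau>\<in>{\<tau>. strictly_refines k \<tau> (one_block k)}.
        (\<Sum>\<pi>\<in>{\<pi>. refines {1..k} \<pi> \<tau>}. f \<pi> * of_int (mobius k \<pi> \<tau>)) * delta \<tau> x)"

definition partition_rank_one ::
    "nat \<Rightarrow> 'a set \<Rightarrow> ((nat \<Rightarrow> 'a) \<Rightarrow> 'f::field) \<Rightarrow> bool" where
  "partition_rank_one k A T \<longleftrightarrow>
     (\<exists>\<pi>\<in>set_partitions k. card \<pi> \<ge> 2 \<and>
        (\<exists>g :: nat set \<Rightarrow> (nat \<Rightarrow> 'a) \<Rightarrow> 'f.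
           \<forall>x\<in>tuples k A. T x = (\<Prod>B\<in>\<pi>. g B (restrict x B))))"

text \<open>
  The rank takes values in the extended naturals: for \<open>k = 1\<close> there are no
  functions of partition rank one, so a nonzero function has rank \<open>\<infinity>\<close>.
\<close>

definition partition_rank ::
    "nat \<Rightarrow> 'a set \<Rightarrow> ((nat \<Rightarrow> 'a) \<Rightarrow> 'f::field) \<Rightarrow> enat" where
  "partition_rank k A T =
     (INF r\<in>{r. \<exists>S :: nat \<Rightarrow> (nat \<Rightarrow> 'a) \<Rightarrow> 'f.
                  (\<forall>i<r. partition_rank_one k A (S i)) \<and>
                  (\<forall>x\<in>tuples k A. T x = (\<Sum>i<r. S i x))}. enat r)"

end

theory Submission
  imports Defs
begin

text \<open>
  Two facts are combined. Summing the defining recursion of the Moebius function against \<open>f\<close>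
  shows that \<open>I\<^sub>f\<close> takes the value \<open>f(\<rho>)\<close> at a tuple with partition \<open>\<rho> < 1\<close>, and minus the sum
  in (4) at a constant tuple; hence \<open>I\<^sub>f \<cdot> T\<close> is supported exactly on the diagonal.
  Secondly, a tensor with nonzero diagonal that vanishes off the diagonal has partition rank at
  least \<open>card A\<close>: choose a function \<open>h\<close> of one variable, orthogonal to the factors of all terms
  that split off that variable alone, with at most one zero for each such term. Multiplying by
  \<open>h\<close> and summing over the variable removes these terms and leaves a diagonal
  tensor in one variable less, so one can induct on the number of variables.
\<close>

section \<open>Partition rank of diagonal tensors\<close>

text \<open>Gaussian elimination: each vector that is not yet zero uses up one pivot point, where
  the value of \<open>h\<close> is forced. At all other points \<open>h\<close> stays 1, so its
  zeros lie among the pivots.\<close>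

lemma orthogonal_with_few_zeros:
  fixes u :: "'i \<Rightarrow> 'a \<Rightarrow> 'f::field"
  assumes "finite R" "finite S"
  shows "\<exists>h. (\<forall>i\<in>R. (\<Sum>a\<in>S. h a * u i a) = 0) \<and> card {a\<in>S. h a = 0} \<le> card R"
  using assms
proof (induction R arbitrary: S u rule: finite_induct)
  case empty
  show ?case by (rule exI[of _ "\<lambda>_. 1"]) simp
next
  case (insert r R)
  show ?case
  proof (cases "\<forall>a\<in>S. u r a = 0")
    case True
    obtain h where h: "\<forall>i\<in>R. (\<Sum>a\<in>S. h a * u i a) = 0" "card {a\<in>S. h a = 0} \<le> card R"
      using insert.IH[OF insert.prems, of u] by blast
    have "(\<Sum>a\<in>S. h a * u r a) = 0"
      using True by simp
    with h insert.hyps show ?thesis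
      by (intro exI[of _ h]) auto
  next
    case False
    then obtain p where p: "p \<in> S" "u r p \<noteq> 0" by blast
    \<comment> \<open>Clearing with \<open>u r\<close> makes \<open>w i p = 0\<close>, so the
      constraints given by \<open>w\<close> live on \<open>S - {p}\<close>.\<close>
    define w where "w i a = u i a - u i p / u r p * u r a" for i a
    obtain h where h: "\<forall>i\<in>R. (\<Sum>a\<in>S - {p}. h a * w i a) = 0"
        "card {a\<in>S - {p}. h a = 0} \<le> card R"
      using insert.IH[of "S - {p}" w] insert.prems by blast
    \<comment> \<open>The value at \<open>p\<close> solves the equation for \<open>u r\<close>; it
      leaves the sums against \<open>w\<close> unchanged and creates at most one new zero.\<close>
    define h' where "h' = h(p := - (\<Sum>a\<in>S - {p}. h a * u r a) / u r p)"
    have split: "(\<Sum>a\<in>S. h' a * v a) = h' p * v p + (\<Sum>a\<in>S - {p}. h a * v a)" for v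
      by (subst sum.remove[OF insert.prems p(1)]) (simp add: h'_def)
    have r: "(\<Sum>a\<in>S. h' a * u r a) = 0"
      unfolding split using p(2) by (simp add: h'_def)
    have "(\<Sum>a\<in>S. h' a * u i a) = 0" if "i \<in> R" for i
    proof -
      have "(\<Sum>a\<in>S. h' a * u i a) =
          (\<Sum>a\<in>S. h' a * w i a) + u i p / u r p * (\<Sum>a\<in>S. h' a * u r a)"
        unfolding sum_distrib_left sum.distrib[symmetric]
        by (rule sum.cong) (simp_all add: w_def algebra_simps)
      also have "(\<Sum>a\<in>S. h' a * w i a) = 0"
        unfolding split using h(1) that p(2) by (simp add: w_def)
      finally show ?thesis using r by simp
    qed
    moreover have "card {a\<in>S. h' a = 0} \<le> card (insert r R)"
    proof -
      have "{a\<in>S. h' a = 0} \<subseteq> insert p {a\<in>S - {p}. h a = 0}"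
        by (auto simp: h'_def)
      then have "card {a\<in>S. h' a = 0} \<le> card (insert p {a\<in>S - {p}. h a = 0})"
        using insert.prems by (intro card_mono) auto
      also have "\<dots> \<le> Suc (card {a\<in>S - {p}. h a = 0})"
        by (rule card_insert_le_m1) simp_all
      finally show ?thesis using h(2) insert.hyps by simp
    qed
    ultimately show ?thesis using r
      by (intro exI[of _ h']) auto
  qed
qed

text \<open>A product over several blocks takes this two-factor form once all blocks but one are
  merged. The index set is arbitrary so that variables can be removed one by one.\<close>

definition splits :: "'i set \<Rightarrow> 'a set \<Rightarrow> (('i \<Rightarrow> 'a) \<Rightarrow> 'f::field) \<Rightarrow> bool" where
  "splits I A s \<longleftrightarrow> (\<exists>B g h. B \<noteq> {} \<and> B \<subset> I \<and>
     (\<forall>x\<in>I \<rightarrow>\<^sub>E A. s x = g (restrict x B) * h (restrict x (I - B))))"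

text \<open>The two factors play symmetric roles, so they are exchanged when \<open>n\<close> lies
  outside \<open>B\<close>.\<close>

lemma splits_containing:
  assumes "splits I A s" "n \<in> I"
  obtains B g h where "n \<in> B" "B \<subset> I"
    "\<forall>x\<in>I \<rightarrow>\<^sub>E A. s x = g (restrict x B) * h (restrict x (I - B))"
proof -
  obtain B g h where B: "B \<noteq> {}" "B \<subset> I"
      "\<forall>x\<in>I \<rightarrow>\<^sub>E A. s x = g (restrict x B) * h (restrict x (I - B))"
    using assms(1) unfolding splits_def by blast
  show thesis
  proof (cases "n \<in> B")
    case True
    then show thesis using B that by blast
  next
    case False
    have "I - (I - B) = B" using B(2) by blast
    then show thesis
      using that[of "I - B" h g] B False assms(2) by (auto simp: mult.commute)
  qed
qed

text \<open>Summing over the coordinate \<open>n\<close> affects only the factor whose block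
  contains \<open>n\<close>. If that block is larger than \<open>{n}\<close>, deleting
  \<open>n\<close> leaves a nonempty proper subset of \<open>I\<close> and the product form
  survives; otherwise \<open>n\<close> was split off alone.\<close>

lemma splits_sum_out:
  fixes s :: "('i \<Rightarrow> 'a) \<Rightarrow> 'f::field"
  assumes "splits (insert n I) A s" "n \<notin> I" "S \<subseteq> A"
  shows "(\<exists>g h. \<forall>x\<in>I \<rightarrow>\<^sub>E A. \<forall>a\<in>A. s (x(n := a)) = g a * h x) \<or>
    splits I A (\<lambda>x. \<Sum>a\<in>S. c a * s (x(n := a)))"
proof -
  obtain B g h where B: "n \<in> B" "B \<subset> insert n I" and
      s: "\<forall>x\<in>insert n I \<rightarrow>\<^sub>E A. s x = g (restrict x B) * h (restrict x (insert n I - B))"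
    by (rule splits_containing[OF assms(1) insertI1])
  have upd: "s (x(n := a)) =
      g ((restrict x (B - {n}))(n := a)) * h (restrict x (I - (B - {n})))"
    if "x \<in> I \<rightarrow>\<^sub>E A" "a \<in> A" for x a
  proof -
    have "restrict (x(n := a)) B = (restrict x (B - {n}))(n := a)"
      using B(1) by (auto simp: fun_eq_iff restrict_def)
    moreover have "restrict (x(n := a)) (insert n I - B) = restrict x (I - (B - {n}))"
      using B(1) assms(2) by (auto simp: fun_eq_iff restrict_def)
    moreover have "x(n := a) \<in> insert n I \<rightarrow>\<^sub>E A"
      using that by (simp add: PiE_fun_upd)
    ultimately show ?thesis using bspec[OF s, of "x(n := a)"] by (simp only:)
  qed
  show ?thesis
  proof (cases "B = {n}")
    case True
    \<comment> \<open>With \<open>B = {n}\<close> no coordinate of \<open>x\<close> remains in the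
      first factor, whose argument is \<open>undefined\<close> away from \<open>n\<close>.\<close>
    have "restrict x {} = (\<lambda>_. undefined)" for x :: "'i \<Rightarrow> 'a"
      by (simp add: restrict_def)
    then have "\<forall>x\<in>I \<rightarrow>\<^sub>E A. \<forall>a\<in>A. s (x(n := a)) = g ((\<lambda>_. undefined)(n := a)) * h (restrict x I)"
      using upd True by simp
    then show ?thesis
      by (intro disjI1 exI[of _ "\<lambda>a. g ((\<lambda>_. undefined)(n := a))"] exI[of _ "\<lambda>x. h (restrict x I)"])
  next
    case False
    have "B - {n} \<noteq> {}" "B - {n} \<subset> I" using False B assms(2) by blast+
    moreover have "(\<Sum>a\<in>S. c a * s (x(n := a))) =
        (\<lambda>y. \<Sum>a\<in>S. c a * g (y(n := a))) (restrict x (B - {n})) *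
        h (restrict x (I - (B - {n})))" if "x \<in> I \<rightarrow>\<^sub>E A" for x
      using upd[OF that] assms(3) by (auto simp: sum_distrib_right mult.assoc intro!: sum.cong)
    ultimately have "splits I A (\<lambda>x. \<Sum>a\<in>S. c a * s (x(n := a)))"
      unfolding splits_def
      by (intro exI[of _ "B - {n}"] exI[of _ "\<lambda>y. \<Sum>a\<in>S. c a * g (y(n := a))"] exI[of _ h]
          conjI ballI)
    then show ?thesis ..
  qed
qed

text \<open>Counting nonzero diagonal entries, instead of assuming all of them nonzero, is what
  makes the induction work: entries lost at zeros of the weight \<open>c\<close> are paid for by the
  terms that \<open>c\<close> annihilates.\<close>

lemma diagonal_rank_bound:
  fixes s :: "'r \<Rightarrow> ('i \<Rightarrow> 'a) \<Rightarrow> 'f::field"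
  assumes "finite I" "I \<noteq> {}" "finite A" "finite R"
    and "\<And>r. r \<in> R \<Longrightarrow> splits I A (s r)"
    and "\<And>x. x \<in> I \<rightarrow>\<^sub>E A \<Longrightarrow> x \<notin> (\<lambda>a. \<lambda>i\<in>I. a) ` A \<Longrightarrow> (\<Sum>r\<in>R. s r x) = 0"
  shows "card {a\<in>A. (\<Sum>r\<in>R. s r (\<lambda>i\<in>I. a)) \<noteq> 0} \<le> card R"
  using assms
proof (induction I arbitrary: R s rule: finite_ne_induct)
  case (singleton n)
  \<comment> \<open>\<open>{n}\<close> has no nonempty proper subset, so nothing splits in one
    variable.\<close>
  have "R = {}"
    using singleton.prems(3) unfolding splits_def by blast
  then show ?case by simp
next
  case (insert n I)
  define t where "t x = (\<Sum>r\<in>R. s r x)" for x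
  define S where "S = {a\<in>A. t (\<lambda>i\<in>insert n I. a) \<noteq> 0}"
  have S: "S \<subseteq> A" "finite S" using insert.prems(1) by (auto simp: S_def)
  \<comment> \<open>The terms that split off the coordinate \<open>n\<close> alone.\<close>
  define Q where "Q = {r\<in>R. \<exists>g h. \<forall>x\<in>I \<rightarrow>\<^sub>E A. \<forall>a\<in>A. s r (x(n := a)) = g a * h x}"
  have Q: "Q \<subseteq> R" "finite Q" using insert.prems(2) by (auto simp: Q_def)
  have "\<forall>r\<in>Q. \<exists>g h. \<forall>x\<in>I \<rightarrow>\<^sub>E A. \<forall>a\<in>A. s r (x(n := a)) = g a * h x"
    by (simp add: Q_def)
  then obtain u v where uv: "\<And>r x a. r \<in> Q \<Longrightarrow> x \<in> I \<rightarrow>\<^sub>E A \<Longrightarrow> a \<in> A \<Longrightarrow>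
      s r (x(n := a)) = u r a * v r x"
    by metis
  \<comment> \<open>The weight lives on \<open>S\<close>, so the zeros counted are exactly those
    that cost a nonzero diagonal entry.\<close>
  obtain c where c: "\<forall>r\<in>Q. (\<Sum>a\<in>S. c a * u r a) = 0" "card {a\<in>S. c a = 0} \<le> card Q"
    using orthogonal_with_few_zeros[OF Q(2) S(2), of u] by blast
  define s' where "s' r x = (\<Sum>a\<in>S. c a * s r (x(n := a)))" for r x
  have zero: "s' r x = 0" if "r \<in> Q" "x \<in> I \<rightarrow>\<^sub>E A" for r x
  proof -
    have "s' r x = (\<Sum>a\<in>S. c a * u r a) * v r x"
      unfolding s'_def sum_distrib_right
      using uv[OF that] S(1) by (intro sum.cong) (auto simp: mult.assoc)
    then show ?thesis using c(1) that(1) by simp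
  qed
  have sum': "(\<Sum>r\<in>R - Q. s' r x) = (\<Sum>a\<in>S. c a * t (x(n := a)))"
    if "x \<in> I \<rightarrow>\<^sub>E A" for x
  proof -
    have "(\<Sum>r\<in>R - Q. s' r x) = (\<Sum>r\<in>R. s' r x)"
      using zero that Q insert.prems(2) by (intro sum.mono_neutral_left) auto
    also have "\<dots> = (\<Sum>a\<in>S. c a * t (x(n := a)))"
      unfolding s'_def t_def sum_distrib_left by (rule sum.swap)
    finally show ?thesis .
  qed
  \<comment> \<open>If \<open>x(n := a)\<close> is constant, evaluation at \<open>n\<close> shows
    that the constant is \<open>a\<close>, which determines \<open>x\<close> on \<open>I\<close>;
    outside \<open>I\<close> the tuple is \<open>undefined\<close>.\<close>
  have off: "t (x(n := a)) = 0"
    if "x \<in> I \<rightarrow>\<^sub>E A" "a \<in> A" "x \<noteq> (\<lambda>i\<in>I. a)" for x a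
  proof -
    have "x(n := a) \<notin> (\<lambda>a. \<lambda>i\<in>insert n I. a) ` A"
    proof
      assume "x(n := a) \<in> (\<lambda>a. \<lambda>i\<in>insert n I. a) ` A"
      then obtain b where b: "x(n := a) = (\<lambda>i\<in>insert n I. b)" by blast
      have "x i = (\<lambda>i\<in>I. a) i" for i
        using fun_cong[OF b, of n] fun_cong[OF b, of i] PiE_arb[OF that(1), of i] insert.hyps(3)
        by (auto simp: restrict_def split: if_splits)
      then show False using that(3) by (simp add: ext)
    qed
    moreover have "x(n := a) \<in> insert n I \<rightarrow>\<^sub>E A"
      using that by (simp add: PiE_fun_upd)
    ultimately show ?thesis
      unfolding t_def by (intro insert.prems(4))
  qed
  define W where "W = {a\<in>A. (\<Sum>r\<in>R - Q. s' r (\<lambda>i\<in>I. a)) \<noteq> 0}"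
  have W: "card W \<le> card (R - Q)"
    unfolding W_def
  proof (rule insert.IH)
    show "splits I A (s' r)" if "r \<in> R - Q" for r
    proof -
      have "splits (insert n I) A (s r)" using insert.prems(3) that by simp
      note splits_sum_out[OF this insert.hyps(3) S(1), of c]
      moreover have "\<nexists>g h. \<forall>x\<in>I \<rightarrow>\<^sub>E A. \<forall>a\<in>A. s r (x(n := a)) = g a * h x"
        using that unfolding Q_def by simp
      ultimately show ?thesis
        by (simp only: s'_def[abs_def] simp_thms)
    qed
    show "(\<Sum>r\<in>R - Q. s' r x) = 0"
      if "x \<in> I \<rightarrow>\<^sub>E A" "x \<notin> (\<lambda>a. \<lambda>i\<in>I. a) ` A" for x
      unfolding sum'[OF that(1)] using off[OF that(1)] that(2) S(1)
      by (intro sum.neutral) (auto simp: subset_iff)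
  qed (use insert.prems in auto)
  \<comment> \<open>At the constant tuple \<open>b\<close> only the summand \<open>a = b\<close>
    survives, giving \<open>c b\<close> times a nonzero diagonal entry.\<close>
  have "{a\<in>S. c a \<noteq> 0} \<subseteq> W"
  proof
    fix b assume "b \<in> {a\<in>S. c a \<noteq> 0}"
    then have b: "b \<in> S" "b \<in> A" "c b \<noteq> 0" using S(1) by auto
    have x: "(\<lambda>i\<in>I. b) \<in> I \<rightarrow>\<^sub>E A" using b by auto
    \<comment> \<open>Distinct values give distinct constant tuples because \<open>I\<close> is
      nonempty.\<close>
    have ne: "(\<lambda>i\<in>I. b) \<noteq> (\<lambda>i\<in>I. a)" if "a \<noteq> b" for a
      using that insert.hyps(2) by (auto simp: fun_eq_iff restrict_def)
    have "(\<Sum>r\<in>R - Q. s' r (\<lambda>i\<in>I. b)) =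
        (\<Sum>a\<in>S. if a = b then c b * t ((\<lambda>i\<in>I. b)(n := b)) else 0)"
      unfolding sum'[OF x] using off[OF x] ne S(1) by (intro sum.cong) (auto simp: subset_iff)
    also have "\<dots> = c b * t ((\<lambda>i\<in>I. b)(n := b))"
      using b S(2) by simp
    also have "(\<lambda>i\<in>I. b)(n := b) = (\<lambda>i\<in>insert n I. b)"
      by (auto simp: fun_eq_iff restrict_def)
    finally have "(\<Sum>r\<in>R - Q. s' r (\<lambda>i\<in>I. b)) \<noteq> 0"
      using b by (simp only: S_def mem_Collect_eq mult_eq_0_iff) simp
    then show "b \<in> W"
      using b(2) unfolding W_def by blast
  qed
  moreover have "finite W" using insert.prems(1) by (simp add: W_def)
  ultimately have "card {a\<in>S. c a \<noteq> 0} \<le> card (R - Q)"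
    using W card_mono le_trans by blast
  moreover have "card S = card {a\<in>S. c a = 0} + card {a\<in>S. c a \<noteq> 0}"
  proof -
    have "S - {a\<in>S. c a = 0} = {a\<in>S. c a \<noteq> 0}" by blast
    then show ?thesis
      using S(2) card_Diff_subset[of "{a\<in>S. c a = 0}" S] card_mono[of S "{a\<in>S. c a = 0}"]
      by simp
  qed
  moreover have "card (R - Q) + card Q = card R"
    using Q insert.prems(2) by (simp add: card_Diff_subset card_mono)
  \<comment> \<open>Zeros of \<open>c\<close> are charged to \<open>Q\<close>, the other points of
    \<open>S\<close> to \<open>R - Q\<close>.\<close>
  ultimately have "card S \<le> card R" using c(2) by linarith
  then show ?case unfolding S_def t_def .
qed

text \<open>One block is set against the product of all the others; a second block, nonempty and
  disjoint from the first, makes the first a proper subset.\<close>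

lemma partition_rank_one_splits:
  assumes "partition_rank_one k A T"
  shows "splits {1..k} A T"
proof -
  obtain \<pi> g where \<pi>: "partition_on {1..k} \<pi>" "card \<pi> \<ge> 2"
    and T: "\<forall>x\<in>tuples k A. T x = (\<Prod>B\<in>\<pi>. g B (restrict x B))"
    using assms unfolding partition_rank_one_def set_partitions_def by auto
  have fin: "finite \<pi>" using \<pi>(2) by (metis card.infinite not_numeral_le_zero)
  have "\<exists>B\<in>\<pi>. \<exists>C\<in>\<pi>. B \<noteq> C"
  proof (rule ccontr)
    assume *: "\<not> ?thesis"
    have "\<pi> \<noteq> {}" using \<pi>(2) by auto
    with * obtain B where "\<pi> = {B}" by blast
    then show False using \<pi>(2) by simp
  qed
  then obtain B C where BC: "B \<in> \<pi>" "C \<in> \<pi>" "B \<noteq> C" by blast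
  have disj: "B \<inter> C = {}" if "C \<in> \<pi>" "C \<noteq> B" for C
    using \<pi>(1) BC that by (metis disjointD partition_onD2)
  have ne: "B \<noteq> {}" "C \<noteq> {}" and sub: "\<And>C. C \<in> \<pi> \<Longrightarrow> C \<subseteq> {1..k}"
    using \<pi>(1) BC by (auto simp: partition_on_def)
  have "B \<subset> {1..k}" using disj[OF BC(2)] BC ne sub[OF BC(1)] sub[OF BC(2)] by blast
  moreover have "T x = g B (restrict x B) *
      (\<lambda>y. \<Prod>C\<in>\<pi> - {B}. g C (restrict y C)) (restrict x ({1..k} - B))"
    if "x \<in> tuples k A" for x
  proof -
    have "restrict (restrict x ({1..k} - B)) C = restrict x C" if "C \<in> \<pi> - {B}" for C
    proof -
      have "({1..k} - B) \<inter> C = C" using that disj[of C] sub[of C] by blast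
      then show ?thesis by simp
    qed
    then show ?thesis
      using T that prod.remove[OF fin BC(1), of "\<lambda>C. g C (restrict x C)"] by simp
  qed
  ultimately show ?thesis
    unfolding splits_def using ne(1)
    by (intro exI[of _ B] exI[of _ "g B"] exI[of _ "\<lambda>y. \<Prod>C\<in>\<pi> - {B}. g C (restrict y C)"]
        conjI ballI)
qed

section \<open>Moebius inversion on the partition lattice\<close>

lemma finite_refines: "finite {\<pi>. refines {1..k::nat} \<pi> \<rho>}"
proof (rule finite_subset)
  show "{\<pi>. refines {1..k} \<pi> \<rho>} \<subseteq> {\<pi>. partition_on {1..k} \<pi>}"
    by (auto simp: refines_def)
qed (simp add: finitely_many_partition_on)

lemma refines_refl_on: "partition_on I \<pi> \<Longrightarrow> refines I \<pi> \<pi>"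
  by (auto simp: refines_def)

lemma refines_strictly_refines_trans:
  assumes "refines {1..k} \<pi> \<tau>" "strictly_refines k \<tau> \<rho>"
  shows "strictly_refines k \<pi> \<rho>"
  using assms refines_trans[of "{1..k}" \<pi> \<tau> \<rho>] refines_asym[of "{1..k}" \<tau> \<rho>]
  unfolding strictly_refines_def by blast

lemma sum_mobius_strict:
  assumes "strictly_refines k \<pi> \<rho>"
  shows "(\<Sum>\<tau>\<in>{\<tau>. refines {1..k} \<pi> \<tau> \<and> strictly_refines k \<tau> \<rho>}. mobius k \<pi> \<tau>)
    = - mobius k \<pi> \<rho>"
  using assms by (subst (2) mobius.simps) (auto simp: strictly_refines_def)

text \<open>The top term of a nontrivial interval cancels the strict part by the recursion. The
  second argument varies, as it does there.\<close>

lemma sum_mobius: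
  assumes "refines {1..k} \<pi> \<rho>"
  shows "(\<Sum>\<tau>\<in>{\<tau>. refines {1..k} \<pi> \<tau> \<and> refines {1..k} \<tau> \<rho>}. mobius k \<pi> \<tau>)
    = (if \<pi> = \<rho> then 1 else 0)"
proof (cases "\<pi> = \<rho>")
  case True
  then have "{\<tau>. refines {1..k} \<pi> \<tau> \<and> refines {1..k} \<tau> \<rho>} = {\<rho>}"
    using assms refines_asym by blast
  moreover have "\<rho> \<in> set_partitions k"
    using assms by (simp add: refines_def set_partitions_def)
  ultimately show ?thesis
    using True by (simp add: mobius.simps)
next
  case False
  then have strict: "strictly_refines k \<pi> \<rho>"
    using assms by (simp add: strictly_refines_def)
  have "{\<tau>. refines {1..k} \<pi> \<tau> \<and> refines {1..k} \<tau> \<rho>} =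
      insert \<rho> {\<tau>. refines {1..k} \<pi> \<tau> \<and> strictly_refines k \<tau> \<rho>}"
    using assms by (auto simp: strictly_refines_def refines_def)
  moreover have "finite {\<tau>. refines {1..k} \<pi> \<tau> \<and> strictly_refines k \<tau> \<rho>}"
    by (rule finite_subset[OF _ finite_refines[of k \<rho>]]) (auto simp: strictly_refines_def)
  ultimately show ?thesis
    using False sum_mobius_strict[OF strict] by (simp add: strictly_refines_def)
qed

text \<open>\<open>X\<close> is closed downwards, so both sides sum over the pairs \<pi> \<le>
  \<tau> inside \<open>X\<close>. It serves for the partitions below a given \<rho> and for those
  strictly below the top.\<close>

lemma sum_refines_swap:
  fixes F :: "nat set set \<Rightarrow> nat set set \<Rightarrow> 'b::comm_monoid_add"
  assumes "finite X" "\<And>\<pi> \<tau>. \<tau> \<in> X \<Longrightarrow> refines {1..k} \<pi> \<tau> \<Longrightarrow> \<pi> \<in> X"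
  shows "(\<Sum>\<tau>\<in>X. \<Sum>\<pi>\<in>{\<pi>. refines {1..k} \<pi> \<tau>}. F \<pi> \<tau>) =
    (\<Sum>\<pi>\<in>X. \<Sum>\<tau>\<in>{\<tau>. refines {1..k} \<pi> \<tau> \<and> \<tau> \<in> X}. F \<pi> \<tau>)"
proof -
  have "{\<pi>. refines {1..k} \<pi> \<tau>} = {\<pi> \<in> X. refines {1..k} \<pi> \<tau>}" if "\<tau> \<in> X" for \<tau>
    using assms(2)[OF that] by blast
  moreover have "{\<tau>. refines {1..k} \<pi> \<tau> \<and> \<tau> \<in> X} = {\<tau> \<in> X. refines {1..k} \<pi> \<tau>}" for \<pi>
    by blast
  ultimately show ?thesis
    using sum.swap_restrict[OF assms(1) assms(1), of "\<lambda>\<tau> \<pi>. F \<pi> \<tau>" "\<lambda>\<tau> \<pi>. refines {1..k} \<pi> \<tau>"]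
    by simp
qed

text \<open>After the swap, the coefficient of \<open>f \<pi>\<close> is the Moebius sum over the
  interval from \<pi> to \<rho>, which survives only at \<pi> = \<rho>.\<close>

lemma mobius_inversion:
  fixes f :: "nat set set \<Rightarrow> 'f::field"
  assumes "partition_on {1..k} \<rho>"
  shows "(\<Sum>\<tau>\<in>{\<tau>. refines {1..k} \<tau> \<rho>}.
    \<Sum>\<pi>\<in>{\<pi>. refines {1..k} \<pi> \<tau>}. f \<pi> * of_int (mobius k \<pi> \<tau>)) = f \<rho>"
proof -
  let ?X = "{\<tau>. refines {1..k} \<tau> \<rho>}"
  have "(\<Sum>\<tau>\<in>?X. \<Sum>\<pi>\<in>{\<pi>. refines {1..k} \<pi> \<tau>}. f \<pi> * of_int (mobius k \<pi> \<tau>)) =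
      (\<Sum>\<pi>\<in>?X. \<Sum>\<tau>\<in>{\<tau>. refines {1..k} \<pi> \<tau> \<and> \<tau> \<in> ?X}. f \<pi> * of_int (mobius k \<pi> \<tau>))"
    using refines_trans by (intro sum_refines_swap finite_refines) blast
  also have "\<dots> = (\<Sum>\<pi>\<in>?X. f \<pi> * of_int
      (\<Sum>\<tau>\<in>{\<tau>. refines {1..k} \<pi> \<tau> \<and> refines {1..k} \<tau> \<rho>}. mobius k \<pi> \<tau>))"
    by (simp add: sum_distrib_left del: One_nat_def)
  also have "\<dots> = (\<Sum>\<pi>\<in>?X. if \<pi> = \<rho> then f \<pi> else 0)"
    by (intro sum.cong refl) (simp add: sum_mobius flip: of_int_sum del: One_nat_def)
  also have "\<dots> = f \<rho>"
    using refines_refl_on[OF assms] finite_refines[of k \<rho>] by simp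
  finally show ?thesis .
qed

section \<open>Partitions of tuples and values of the partition indicator\<close>

lemma tuple_partition_eq_blocks:
  "tuple_partition k x = (\<lambda>i. {j\<in>{1..k}. x i = x j}) ` {1..k}"
  by (auto simp: tuple_partition_def quotient_def)

lemma partition_on_tuple_partition: "partition_on {1..k} (tuple_partition k x)"
  by (auto simp: tuple_partition_eq_blocks partition_on_def disjoint_def)

text \<open>This turns the condition in \<open>delta\<close> into an order relation: the partition
  of \<open>x\<close> is the coarsest one on whose blocks \<open>x\<close> is constant.\<close>

lemma refines_tuple_partition_iff:
  assumes "partition_on {1..k} \<tau>"
  shows "refines {1..k} \<tau> (tuple_partition k x) \<longleftrightarrow> (\<forall>B\<in>\<tau>. \<forall>i\<in>B. \<forall>j\<in>B. x i = x j)"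
proof
  assume "refines {1..k} \<tau> (tuple_partition k x)"
  then have "\<exists>m. B \<subseteq> {j\<in>{1..k}. x m = x j}" if "B \<in> \<tau>" for B
    using that unfolding refines_def tuple_partition_eq_blocks by blast
  then show "\<forall>B\<in>\<tau>. \<forall>i\<in>B. \<forall>j\<in>B. x i = x j"
    by (metis (mono_tags, lifting) mem_Collect_eq subsetD)
next
  assume const: "\<forall>B\<in>\<tau>. \<forall>i\<in>B. \<forall>j\<in>B. x i = x j"
  have "\<exists>C\<in>tuple_partition k x. B \<subseteq> C" if B: "B \<in> \<tau>" for B
  proof -
    have sub: "B \<subseteq> {1..k}" "B \<noteq> {}" using assms B by (auto simp: partition_on_def)
    then obtain i where i: "i \<in> B" by blast
    have "B \<subseteq> {j\<in>{1..k}. x i = x j}" using const B i sub by blast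
    then show ?thesis
      unfolding tuple_partition_eq_blocks using i sub by blast
  qed
  then show "refines {1..k} \<tau> (tuple_partition k x)"
    using assms partition_on_tuple_partition by (simp add: refines_def)
qed

lemma partition_on_one_block: "k > 0 \<Longrightarrow> partition_on {1..k} (one_block k)"
  by (simp add: one_block_def partition_on_def)

lemma refines_one_block: "k > 0 \<Longrightarrow> partition_on {1..k} \<tau> \<Longrightarrow> refines {1..k} \<tau> (one_block k)"
  using partition_on_one_block[of k] by (auto simp: refines_def one_block_def partition_on_def)

text \<open>Every partition refines the top, so by antisymmetry equality amounts to the top refining
  the partition of \<open>x\<close>.\<close>

lemma tuple_partition_eq_one_block_iff:
  assumes "k > 0"
  shows "tuple_partition k x = one_block k \<longleftrightarrow> (\<forall>i\<in>{1..k}. \<forall>j\<in>{1..k}. x i = x j)"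
proof -
  have "tuple_partition k x = one_block k \<longleftrightarrow>
      refines {1..k} (one_block k) (tuple_partition k x)"
    using refines_one_block[OF assms partition_on_tuple_partition]
      refines_refl_on[OF partition_on_one_block[OF assms]] refines_asym by metis
  then show ?thesis
    using refines_tuple_partition_iff[OF partition_on_one_block[OF assms], of x]
    by (simp add: one_block_def)
qed

text \<open>\<open>delta\<close> selects the \<tau> below the partition of \<open>x\<close>. All of
  these lie strictly below the top, so the truncated sum is a complete inversion sum.\<close>

lemma partition_indicator_off_diagonal:
  fixes f :: "nat set set \<Rightarrow> 'f::field"
  assumes "k > 0" "tuple_partition k x \<noteq> one_block k"
  shows "partition_indicator k f x = f (tuple_partition k x)"
proof -
  let ?\<rho> = "tuple_partition k x"
  let ?X = "{\<tau>. strictly_refines k \<tau> (one_block k)}"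
  let ?F = "\<lambda>\<tau>. \<Sum>\<pi>\<in>{\<pi>. refines {1..k} \<pi> \<tau>}. f \<pi> * of_int (mobius k \<pi> \<tau>)"
  have strict: "strictly_refines k ?\<rho> (one_block k)"
    using assms refines_one_block[OF assms(1) partition_on_tuple_partition]
    unfolding strictly_refines_def by blast
  have sub: "{\<tau>. refines {1..k} \<tau> ?\<rho>} \<subseteq> ?X"
    using strict refines_strictly_refines_trans by blast
  have delta: "delta \<tau> x = (if refines {1..k} \<tau> ?\<rho> then 1 else (0::'f))" if "\<tau> \<in> ?X" for \<tau>
    using that by (subst refines_tuple_partition_iff)
      (auto simp: delta_def strictly_refines_def refines_def)
  have "finite ?X"
    by (rule finite_subset[OF _ finite_refines[of k "one_block k"]])
      (auto simp: strictly_refines_def)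
  then have "(\<Sum>\<tau>\<in>{\<tau>. refines {1..k} \<tau> ?\<rho>}. ?F \<tau>) = partition_indicator k f x"
    unfolding partition_indicator_def
    using sub delta by (intro sum.mono_neutral_cong_left) auto
  then show ?thesis
    using mobius_inversion[OF partition_on_tuple_partition, of f k x] by simp
qed

text \<open>Every \<open>delta\<close> equals 1. After the swap the coefficient of
  \<open>f \<pi>\<close> is the Moebius sum over the interval with its top left out, which the
  recursion evaluates.\<close>

lemma partition_indicator_diagonal:
  fixes f :: "nat set set \<Rightarrow> 'f::field"
  assumes "\<forall>i\<in>{1..k}. \<forall>j\<in>{1..k}. x i = x j"
  shows "partition_indicator k f x =
    - (\<Sum>\<pi>\<in>{\<pi>. strictly_refines k \<pi> (one_block k)}. f \<pi> * of_int (mobius k \<pi> (one_block k)))"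
proof -
  let ?X = "{\<tau>. strictly_refines k \<tau> (one_block k)}"
  have delta: "delta \<tau> x = (1::'f)" if "\<tau> \<in> ?X" for \<tau>
  proof -
    have "\<forall>B\<in>\<tau>. B \<subseteq> {1..k}"
      using that by (auto simp: strictly_refines_def refines_def partition_on_def)
    then show ?thesis using assms unfolding delta_def by (auto simp: subset_iff)
  qed
  have "partition_indicator k f x =
      (\<Sum>\<tau>\<in>?X. \<Sum>\<pi>\<in>{\<pi>. refines {1..k} \<pi> \<tau>}. f \<pi> * of_int (mobius k \<pi> \<tau>))"
    unfolding partition_indicator_def using delta by (intro sum.cong) auto
  also have "\<dots> =
      (\<Sum>\<pi>\<in>?X. \<Sum>\<tau>\<in>{\<tau>. refines {1..k} \<pi> \<tau> \<and> \<tau> \<in> ?X}. f \<pi> * of_int (mobius k \<pi> \<tau>))"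
  proof (rule sum_refines_swap)
    show "finite ?X"
      by (rule finite_subset[OF _ finite_refines[of k "one_block k"]])
        (auto simp: strictly_refines_def)
    show "\<pi> \<in> ?X" if "\<tau> \<in> ?X" "refines {1..k} \<pi> \<tau>" for \<pi> \<tau>
      using that refines_strictly_refines_trans by blast
  qed
  also have "\<dots> = (\<Sum>\<pi>\<in>?X. f \<pi> * of_int
      (\<Sum>\<tau>\<in>{\<tau>. refines {1..k} \<pi> \<tau> \<and> strictly_refines k \<tau> (one_block k)}. mobius k \<pi> \<tau>))"
    by (simp add: sum_distrib_left del: One_nat_def)
  also have "\<dots> = (\<Sum>\<pi>\<in>?X. - (f \<pi> * of_int (mobius k \<pi> (one_block k))))"
    by (intro sum.cong refl) (simp add: sum_mobius_strict flip: of_int_sum del: One_nat_def)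
  finally show ?thesis by (simp add: sum_negf)
qed

section \<open>Support of the product and the rank bound\<close>

theorem mainTheorem2:
  fixes k :: nat
    and A :: "'a set"
    and P :: "(nat \<Rightarrow> 'a) \<Rightarrow> bool"
    and T :: "(nat \<Rightarrow> 'a) \<Rightarrow> 'f::field"
    and f :: "nat set set \<Rightarrow> 'f"
  assumes "k > 0"
    and "finite A"
    and "\<forall>a\<in>A. P (\<lambda>i\<in>{1..k}. a)"
    and "\<forall>x\<in>tuples k A. T x = (if P x then 1 else 0)"
    and "\<forall>\<pi>\<in>set_partitions k - {one_block k}.
           (\<exists>x\<in>tuples k A. tuple_partition k x = \<pi> \<and> P x) \<longrightarrow> f \<pi> = 0"
    and "(\<Sum>\<pi>\<in>{\<pi>. strictly_refines k \<pi> (one_block k)}.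
            f \<pi> * of_int (mobius k \<pi> (one_block k))) \<noteq> 0"
  shows "enat (card A) \<le> partition_rank k A (\<lambda>x. partition_indicator k f x * T x)"
proof -
  let ?D = "\<lambda>x. partition_indicator k f x * T x"
  \<comment> \<open>Here the indicator equals \<open>f\<close> at the partition of \<open>x\<close>:
    this is 0 by the hypothesis on \<open>f\<close> if \<open>P x\<close> holds, and otherwise
    \<open>T x = 0\<close>.\<close>
  have off: "?D x = 0" if x: "x \<in> tuples k A" "x \<notin> (\<lambda>a. \<lambda>i\<in>{1..k}. a) ` A" for x
  proof -
    have "tuple_partition k x \<noteq> one_block k"
    proof
      assume "tuple_partition k x = one_block k"
      then have const: "\<forall>i\<in>{1..k}. \<forall>j\<in>{1..k}. x i = x j"
        using tuple_partition_eq_one_block_iff[OF assms(1)] by blast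
      \<comment> \<open>Coordinate 1 exists because \<open>k > 0\<close> and supplies the common
        value; outside \<open>{1..k}\<close> both tuples are \<open>undefined\<close>.\<close>
      have one: "1 \<in> {1..k}" using assms(1) by simp
      have "x = (\<lambda>i\<in>{1..k}. x 1)"
      proof
        show "x i = (\<lambda>i\<in>{1..k}. x 1) i" for i
          using bspec[OF bspec[OF const], of i 1] one PiE_arb[OF x(1), of i] by auto
      qed
      moreover have "x 1 \<in> A" using x(1) one by (rule PiE_mem)
      ultimately show False using x(2) by (metis imageI)
    qed
    moreover have "tuple_partition k x \<in> set_partitions k"
      unfolding set_partitions_def by (simp add: partition_on_tuple_partition del: One_nat_def)
    ultimately show ?thesis
      using x(1) assms(1,4,5) by (auto simp: partition_indicator_off_diagonal)
  qed
  \<comment> \<open>On the diagonal \<open>T\<close> is 1 and the indicator is minus the sum assumed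
    nonzero.\<close>
  have diag: "?D (\<lambda>i\<in>{1..k}. a) \<noteq> 0" if "a \<in> A" for a
  proof -
    have "(\<lambda>i\<in>{1..k}. a) \<in> tuples k A" using that by auto
    then show ?thesis
      using assms(3,4,6) that by (simp add: partition_indicator_diagonal)
  qed
  have "card A \<le> r"
    if S: "\<forall>i<r. partition_rank_one k A (S i)" "\<forall>x\<in>tuples k A. ?D x = (\<Sum>i<r. S i x)"
    for r and S :: "nat \<Rightarrow> (nat \<Rightarrow> 'a) \<Rightarrow> 'f"
  proof -
    have "card {a\<in>A. (\<Sum>i\<in>{..<r}. S i (\<lambda>i\<in>{1..k}. a)) \<noteq> 0} \<le> card {..<r}"
    proof (rule diagonal_rank_bound)
      show "(\<Sum>i<r. S i x) = 0"
        if "x \<in> tuples k A" "x \<notin> (\<lambda>a. \<lambda>i\<in>{1..k}. a) ` A" for x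
        using off[OF that] bspec[OF S(2) that(1)] by simp
      show "splits {1..k} A (S i)" if "i \<in> {..<r}" for i
        using S(1) that by (intro partition_rank_one_splits) simp
    qed (use assms(1,2) in auto)
    moreover have "(\<Sum>i<r. S i (\<lambda>i\<in>{1..k}. a)) \<noteq> 0" if "a \<in> A" for a
      using bspec[OF S(2), of "\<lambda>i\<in>{1..k}. a"] diag[OF that] that by auto
    then have "{a\<in>A. (\<Sum>i\<in>{..<r}. S i (\<lambda>i\<in>{1..k}. a)) \<noteq> 0} = A" by blast
    ultimately show ?thesis by simp
  qed
  \<comment> \<open>The infimum inherits the bound on every length \<open>r\<close>; it is infinite
    if no decomposition exists.\<close>
  then show ?thesis
    unfolding partition_rank_def by (intro INF_greatest) auto
qed

end
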